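(* Let $\mu$ be a non-trivial probability measure supported on $[-1,1]$ with monic orthogonal polynomials $\{P_n\}_{n\ge 0}$ and recurrence coefficients $\{b_n\}_{n\ge1}$, $\{d_n\}_{n\ge 1}$. Fix a non-negative integer $k$ and let $\{\hat\alpha_n\}_{n\ge 0}$ be the Verblunsky coefficients of the orthogonal polynomials on the unit circle that correspond, through the Szegő transformation, to the associated polynomials of order $k$, $\{P_n^{(k)}\}_{n\ge0}$. Then, with the convention $\hat\alpha_{-1}=-1$, $$\hat\alpha_0=b_{k+1},\qquad \hat\alpha_1=-1+\frac{2d_{k+1}}{1-\hat\alpha_0^2},$$ $$\hat\alpha_{2m}=\frac{2b_{m+k+1}+(1+\hat\alpha_{2m-1})\hat\alpha_{2m-2}}{1-\hat\alpha_{2m-1}},\qquad m\ge1,$$ $$\hat\alpha_{2m+1}=-1+\frac{4d_{m+k+1}}{(1-\hat\alpha_{2m-1})(1-\hat\alpha_{2m}^2)},\qquad m\ge1.$$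
   Context: Non-trivial means with infinite support. The monic orthogonal polynomials $P_n$ of $\mu$ satisfy $P_{n+1}(x)=(x-b_{n+1})P_n(x)-d_nP_{n-1}(x)$, $n\ge0$, $P_{-1}=0$, $P_0=1$, with $b_n\in\mathbb R$, $d_n>0$ for $n\ge 1$. The associated polynomials of order $k$ are given by $P^{(k)}_{n+1}(x)=(x-b_{n+k+1})P^{(k)}_n(x)-d_{n+k}P^{(k)}_{n-1}(x)$, $n\ge 0$, $P^{(k)}_{-1}=0$, $P^{(k)}_0=1$ (for $k=0$ they are the $P_n$); they are the monic orthogonal polynomials of a probability measure $\mu^{(k)}$ supported on $[-1,1]$. Szegő transformation: a probability measure $\nu$ on $[-1,1]$ is sent to the probability measure $\mathrm{Sz}(\nu)$ on the unit circle $\{e^{i\theta}\}$ given by $d\,\mathrm{Sz}(\nu)(\theta)=\frac12|d\nu(\cos\theta)|$, i.e. the measure invariant under $\theta\mapsto-\theta$ whose push-forward under $e^{i\theta}\mapsto\cos\theta$ is $\nu$. For a non-trivial probability measure on the unit circle with monic orthogonal polynomials $\Phi_n$, the Verblunsky coefficients are $\alpha_n=-\overline{\Phi_{n+1}(0)}$, $n\ge0$, so that $\Phi_{n+1}(z)=z\Phi_n(z)-\overline{\alpha_n}\Phi_n^*(z)$, where $\Phi_n^*(z)=z^n\overline{\Phi_n(1/\bar z)}$. The coefficients $\hat\alpha_n$ in the claim are those of $\mathrm{Sz}(\mu^{(k)})$. *)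

theory Defs
  imports "HOL-Probability.Probability" "HOL-Computational_Algebra.Polynomial"
begin

definition prob_measure_on :: "'a::topological_space measure \<Rightarrow> 'a set \<Rightarrow> bool" where
  "prob_measure_on M S \<longleftrightarrow> prob_space M \<and> sets M = sets borel \<and> (AE x in M. x \<in> S)"

definition measure_support :: "'a::topological_space measure \<Rightarrow> 'a set" where
  "measure_support M = {x. \<forall>U. open U \<and> x \<in> U \<longrightarrow> emeasure M U > 0}"

definition monic_orthogonal_polys :: "real measure \<Rightarrow> (nat \<Rightarrow> real poly) \<Rightarrow> bool" where
  "monic_orthogonal_polys M P \<longleftrightarrow>
     (\<forall>n. degree (P n) = n \<and> lead_coeff (P n) = 1) \<and>
     (\<forall>m n. m \<noteq> n \<longrightarrow> (\<integral>x. poly (P m) x * poly (P n) x \<partial>M) = 0)"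

text \<open>The values \<open>b 0\<close> and \<open>d 0\<close> are irrelevant; the \<open>if\<close> expresses the convention that the
  polynomial of index \<open>-1\<close> is zero.\<close>

definition recurrence_coeffs :: "(nat \<Rightarrow> real poly) \<Rightarrow> (nat \<Rightarrow> real) \<Rightarrow> (nat \<Rightarrow> real) \<Rightarrow> bool" where
  "recurrence_coeffs P b d \<longleftrightarrow>
     (\<forall>n\<ge>1. d n > 0) \<and>
     (\<forall>n. P (n + 1) = [:- b (n + 1), 1:] * P n - smult (d n) (if n = 0 then 0 else P (n - 1)))"

fun associated_poly :: "(nat \<Rightarrow> real) \<Rightarrow> (nat \<Rightarrow> real) \<Rightarrow> nat \<Rightarrow> nat \<Rightarrow> real poly" where
  "associated_poly b d k 0 = 1"
| "associated_poly b d k (Suc 0) = [:- b (k + 1), 1:]"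
| "associated_poly b d k (Suc (Suc n)) =
     [:- b (Suc n + k + 1), 1:] * associated_poly b d k (Suc n)
       - smult (d (Suc n + k)) (associated_poly b d k n)"

text \<open>A measure on the unit circle is a Borel measure on \<^typ>\<open>complex\<close> concentrated on
  \<^term>\<open>sphere (0::complex) 1\<close>. There \<open>\<theta> \<mapsto> - \<theta>\<close> is complex conjugation and
  \<open>e\<^sup>i\<^sup>\<theta> \<mapsto> cos \<theta>\<close> is the real part.\<close>

definition is_szego_transform :: "real measure \<Rightarrow> complex measure \<Rightarrow> bool" where
  "is_szego_transform \<nu> \<sigma> \<longleftrightarrow>
     prob_measure_on \<sigma> (sphere 0 1) \<and> distr \<sigma> borel cnj = \<sigma> \<and> distr \<sigma> borel Re = \<nu>"

definition szego_transform :: "real measure \<Rightarrow> complex measure" where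
  "szego_transform \<nu> = (THE \<sigma>. is_szego_transform \<nu> \<sigma>)"

definition monic_orthogonal_polys_circle :: "complex measure \<Rightarrow> (nat \<Rightarrow> complex poly) \<Rightarrow> bool" where
  "monic_orthogonal_polys_circle \<sigma> \<Phi> \<longleftrightarrow>
     (\<forall>n. degree (\<Phi> n) = n \<and> lead_coeff (\<Phi> n) = 1) \<and>
     (\<forall>m n. m \<noteq> n \<longrightarrow> (\<integral>z. cnj (poly (\<Phi> m) z) * poly (\<Phi> n) z \<partial>\<sigma>) = 0)"

definition verblunsky_coeff :: "(nat \<Rightarrow> complex poly) \<Rightarrow> nat \<Rightarrow> complex" where
  "verblunsky_coeff \<Phi> n = - cnj (poly (\<Phi> (n + 1)) 0)"


subsection \<open>The transform is well defined\<close>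

definition upper_arc :: "real \<Rightarrow> complex" where
  "upper_arc x = cis (arccos (max (-1) (min 1 x)))"

lemma upper_arc_measurable [measurable]: "upper_arc \<in> borel_measurable borel"
proof -
  have "continuous_on UNIV (\<lambda>x::real. arccos (max (-1) (min 1 x)))"
    by (rule continuous_on_arccos) (intro continuous_intros, auto simp: max_def min_def)
  then have "continuous_on UNIV (\<lambda>x::real. cis (arccos (max (-1) (min 1 x))))"
    by (rule continuous_on_cis)
  then show ?thesis
    unfolding upper_arc_def by (rule borel_measurable_continuous_onI)
qed

lemma Re_upper_arc: "x \<in> {-1..1} \<Longrightarrow> Re (upper_arc x) = x"
  by (simp add: upper_arc_def)

lemma upper_arc_in_sphere: "upper_arc x \<in> sphere 0 1"
  by (simp add: upper_arc_def)

lemma upper_arc_Re_cases: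
  assumes "z \<in> sphere 0 1"
  shows "z = upper_arc (Re z) \<or> z = cnj (upper_arc (Re z))"
proof -
  let ?w = "upper_arc (Re z)"
  have nz: "(Re z)\<^sup>2 + (Im z)\<^sup>2 = 1"
    using assms cmod_power2[of z] by simp
  have "\<bar>Re z\<bar> \<le> 1"
    using assms abs_Re_le_cmod[of z] by simp
  then have re: "Re ?w = Re z"
    by (intro Re_upper_arc) auto
  have "(Re ?w)\<^sup>2 + (Im ?w)\<^sup>2 = 1"
    using upper_arc_in_sphere[of "Re z"] cmod_power2[of ?w] by simp
  then have "(Im ?w)\<^sup>2 = (Im z)\<^sup>2"
    using nz re by simp
  then have "Im z = Im ?w \<or> Im z = - Im ?w"
    by (metis power2_eq_iff)
  then show ?thesis
    using re by (auto simp: complex_eq_iff)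
qed

lemma measurable_cnj [measurable]: "cnj \<in> borel_measurable borel"
  by (intro borel_measurable_continuous_onI continuous_intros)

lemma szego_emeasure:
  assumes "is_szego_transform \<nu> \<sigma>" "A \<in> sets borel"
  shows "2 * emeasure \<sigma> A = emeasure \<nu> (upper_arc -` A) + emeasure \<nu> ((\<lambda>x. cnj (upper_arc x)) -` A)"
proof -
  have sets [measurable_cong]: "sets \<sigma> = sets borel"
    and sph: "AE z in \<sigma>. z \<in> sphere 0 1"
    and inv: "distr \<sigma> borel cnj = \<sigma>" and push: "\<nu> = distr \<sigma> borel Re"
    using assms(1) by (auto simp: is_szego_transform_def prob_measure_on_def)
  have sp: "space \<sigma> = UNIV"
    using sets_eq_imp_space_eq[OF sets] by simp
  note [measurable] = assms(2)
  have "emeasure \<sigma> A = (\<integral>\<^sup>+z. indicator A z \<partial>\<sigma>)"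
    by simp
  moreover have "emeasure \<sigma> A = (\<integral>\<^sup>+z. indicator A (cnj z) \<partial>\<sigma>)"
  proof -
    have "emeasure \<sigma> A = (\<integral>\<^sup>+z. indicator A z \<partial>distr \<sigma> borel cnj)"
      by (simp add: inv)
    also have "\<dots> = (\<integral>\<^sup>+z. indicator A (cnj z) \<partial>\<sigma>)"
      by (rule nn_integral_distr) measurable
    finally show ?thesis .
  qed
  ultimately have "2 * emeasure \<sigma> A = (\<integral>\<^sup>+z. indicator A z \<partial>\<sigma>) + (\<integral>\<^sup>+z. indicator A (cnj z) \<partial>\<sigma>)"
    by (metis mult_2)
  also have "\<dots> = (\<integral>\<^sup>+z. indicator A z + indicator A (cnj z) \<partial>\<sigma>)"
    by (rule nn_integral_add[symmetric]) measurable
  also have "\<dots> = (\<integral>\<^sup>+z. indicator A (upper_arc (Re z)) + indicator A (cnj (upper_arc (Re z))) \<partial>\<sigma>)"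
  proof (rule nn_integral_cong_AE)
    show "AE z in \<sigma>. (indicator A z + indicator A (cnj z) :: ennreal) =
        indicator A (upper_arc (Re z)) + indicator A (cnj (upper_arc (Re z)))"
      using sph
    proof eventually_elim
      case (elim z)
      from upper_arc_Re_cases[OF elim] show ?case
      proof
        assume "z = upper_arc (Re z)"
        then show ?thesis by metis
      next
        assume "z = cnj (upper_arc (Re z))"
        then show ?thesis by (metis complex_cnj_cnj add.commute)
      qed
    qed
  qed
  also have "\<dots> = (\<integral>\<^sup>+z. indicator A (upper_arc (Re z)) \<partial>\<sigma>) + (\<integral>\<^sup>+z. indicator A (cnj (upper_arc (Re z))) \<partial>\<sigma>)"
    by (rule nn_integral_add) measurable
  also have "(\<integral>\<^sup>+z. indicator A (upper_arc (Re z)) \<partial>\<sigma>) = (\<integral>\<^sup>+x. indicator A (upper_arc x) \<partial>\<nu>)"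
    unfolding push by (rule nn_integral_distr[symmetric]) measurable
  also have "\<dots> = (\<integral>\<^sup>+x. indicator (upper_arc -` A) x \<partial>\<nu>)"
    by (simp add: indicator_def)
  also have "\<dots> = emeasure \<nu> (upper_arc -` A)"
    by (rule nn_integral_indicator)
       (use measurable_sets[OF upper_arc_measurable assms(2)] in \<open>simp add: push\<close>)
  also have "(\<integral>\<^sup>+z. indicator A (cnj (upper_arc (Re z))) \<partial>\<sigma>) = (\<integral>\<^sup>+x. indicator A (cnj (upper_arc x)) \<partial>\<nu>)"
    unfolding push by (rule nn_integral_distr[symmetric]) measurable
  also have "\<dots> = (\<integral>\<^sup>+x. indicator ((\<lambda>x. cnj (upper_arc x)) -` A) x \<partial>\<nu>)"
    by (simp add: indicator_def)
  also have "\<dots> = emeasure \<nu> ((\<lambda>x. cnj (upper_arc x)) -` A)"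
  proof (rule nn_integral_indicator)
    have "(\<lambda>x. cnj (upper_arc x)) \<in> borel_measurable borel" by measurable
    from measurable_sets[OF this assms(2)] show "(\<lambda>x. cnj (upper_arc x)) -` A \<in> sets \<nu>"
      by (simp add: push)
  qed
  finally show ?thesis .
qed

definition szego_witness :: "real measure \<Rightarrow> complex measure" where
  "szego_witness \<nu> = distr (\<nu> \<Otimes>\<^sub>M measure_pmf (bernoulli_pmf (1/2))) borel
     (\<lambda>(x, s). if s then upper_arc x else cnj (upper_arc x))"

lemma nn_integral_szego_witness:
  assumes "prob_measure_on \<nu> {-1..1}" and f [measurable]: "f \<in> borel_measurable borel"
  shows "(\<integral>\<^sup>+z. f z \<partial>szego_witness \<nu>) =
    ((\<integral>\<^sup>+x. f (upper_arc x) \<partial>\<nu>) + (\<integral>\<^sup>+x. f (cnj (upper_arc x)) \<partial>\<nu>)) / 2"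
proof -
  interpret prob_space \<nu> using assms by (simp add: prob_measure_on_def)
  have [measurable_cong]: "sets \<nu> = sets borel"
    using assms by (simp add: prob_measure_on_def)
  interpret B: prob_space "measure_pmf (bernoulli_pmf (1/2))"
    by (rule prob_space_measure_pmf)
  interpret pair_sigma_finite \<nu> "measure_pmf (bernoulli_pmf (1/2))" ..
  let ?h = "\<lambda>(x, s). if s then upper_arc x else cnj (upper_arc x)"
  have [measurable]: "?h \<in> borel_measurable (\<nu> \<Otimes>\<^sub>M measure_pmf (bernoulli_pmf (1/2)))"
    by measurable
  have "(\<integral>\<^sup>+z. f z \<partial>szego_witness \<nu>) = (\<integral>\<^sup>+p. f (?h p) \<partial>(\<nu> \<Otimes>\<^sub>M measure_pmf (bernoulli_pmf (1/2))))"
    unfolding szego_witness_def by (rule nn_integral_distr) measurable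
  also have "\<dots> = (\<integral>\<^sup>+s. (\<integral>\<^sup>+x. f (?h (x, s)) \<partial>\<nu>) \<partial>measure_pmf (bernoulli_pmf (1/2)))"
    by (rule nn_integral_snd[symmetric]) measurable
  also have "\<dots> = ((\<integral>\<^sup>+x. f (upper_arc x) \<partial>\<nu>) + (\<integral>\<^sup>+x. f (cnj (upper_arc x)) \<partial>\<nu>)) / 2"
    by (simp add: divide_ennreal_def ennreal_half distrib_right)
  finally show ?thesis .
qed

lemma is_szego_transform_witness:
  assumes "prob_measure_on \<nu> {-1..1}"
  shows "is_szego_transform \<nu> (szego_witness \<nu>)"
proof -
  interpret prob_space \<nu> using assms by (simp add: prob_measure_on_def)
  have sets_\<nu> [measurable_cong]: "sets \<nu> = sets borel" and AE_\<nu>: "AE x in \<nu>. x \<in> {-1..1}"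
    using assms by (auto simp: prob_measure_on_def)
  have sets_w [measurable_cong, simp]: "sets (szego_witness \<nu>) = sets borel"
    by (simp add: szego_witness_def)
  have [simp]: "space (szego_witness \<nu>) = UNIV"
    by (simp add: szego_witness_def)
  have half: "(x + x) / 2 = x" for x :: ennreal
    by (simp add: ennreal_mult_divide_eq flip: mult_2_right)
  have prob: "prob_space (szego_witness \<nu>)"
  proof
    have "emeasure (szego_witness \<nu>) (space (szego_witness \<nu>)) = (\<integral>\<^sup>+z. 1 \<partial>szego_witness \<nu>)"
      by simp
    also have "\<dots> = 1"
      by (subst nn_integral_szego_witness[OF assms]) (simp_all add: emeasure_space_1 half)
    finally show "emeasure (szego_witness \<nu>) (space (szego_witness \<nu>)) = 1" .
  qed
  have sph: "AE z in szego_witness \<nu>. z \<in> sphere 0 1"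
  proof -
    have meas: "- sphere (0::complex) 1 \<in> sets borel" by simp
    have "emeasure (szego_witness \<nu>) (- sphere 0 1) =
        (\<integral>\<^sup>+z. indicator (- sphere 0 1) z \<partial>szego_witness \<nu>)"
      using meas by simp
    also have "\<dots> = 0"
      by (subst nn_integral_szego_witness[OF assms])
         (use upper_arc_in_sphere in \<open>auto simp: indicator_def\<close>)
    finally show ?thesis
      by (intro AE_I[where N = "- sphere 0 1"]) auto
  qed
  have inv: "distr (szego_witness \<nu>) borel cnj = szego_witness \<nu>"
  proof (rule measure_eqI)
    fix A assume "A \<in> sets (distr (szego_witness \<nu>) borel cnj)"
    then have [measurable]: "A \<in> sets borel" by simp
    have "emeasure (distr (szego_witness \<nu>) borel cnj) A =
        (\<integral>\<^sup>+z. indicator A z \<partial>distr (szego_witness \<nu>) borel cnj)"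
      by simp
    also have "\<dots> = (\<integral>\<^sup>+z. indicator A (cnj z) \<partial>szego_witness \<nu>)"
      by (rule nn_integral_distr) measurable
    also have "\<dots> = (\<integral>\<^sup>+z. indicator A z \<partial>szego_witness \<nu>)"
      by (simp add: nn_integral_szego_witness[OF assms] add.commute del: nn_integral_indicator)
    also have "\<dots> = emeasure (szego_witness \<nu>) A"
      by simp
    finally show "emeasure (distr (szego_witness \<nu>) borel cnj) A = emeasure (szego_witness \<nu>) A" .
  qed simp
  have push: "distr (szego_witness \<nu>) borel Re = \<nu>"
  proof (rule measure_eqI)
    fix A assume "A \<in> sets (distr (szego_witness \<nu>) borel Re)"
    then have [measurable]: "A \<in> sets borel" by simp
    have "emeasure (distr (szego_witness \<nu>) borel Re) A =
        (\<integral>\<^sup>+z. indicator A z \<partial>distr (szego_witness \<nu>) borel Re)"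
      by simp
    also have "\<dots> = (\<integral>\<^sup>+z. indicator A (Re z) \<partial>szego_witness \<nu>)"
      by (rule nn_integral_distr) measurable
    also have "\<dots> = (\<integral>\<^sup>+x. indicator A (Re (upper_arc x)) \<partial>\<nu>)"
      by (simp add: nn_integral_szego_witness[OF assms] half)
    also have "\<dots> = (\<integral>\<^sup>+x. indicator A x \<partial>\<nu>)"
      by (rule nn_integral_cong_AE) (use AE_\<nu> in eventually_elim, simp only: Re_upper_arc)
    also have "\<dots> = emeasure \<nu> A"
      by simp
    finally show "emeasure (distr (szego_witness \<nu>) borel Re) A = emeasure \<nu> A" .
  qed (simp add: sets_\<nu>)
  show ?thesis
    using prob sph inv push by (simp add: is_szego_transform_def prob_measure_on_def)
qed

lemma is_szego_transform_unique:
  assumes "is_szego_transform \<nu> \<sigma>" "is_szego_transform \<nu> \<tau>"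
  shows "\<sigma> = \<tau>"
proof (rule measure_eqI)
  have s: "sets \<sigma> = sets borel" "sets \<tau> = sets borel"
    using assms by (auto simp: is_szego_transform_def prob_measure_on_def)
  then show "sets \<sigma> = sets \<tau>" by simp
  fix A assume "A \<in> sets \<sigma>"
  then have "2 * emeasure \<sigma> A = 2 * emeasure \<tau> A"
    using szego_emeasure[OF assms(1)] szego_emeasure[OF assms(2)] s by simp
  then show "emeasure \<sigma> A = emeasure \<tau> A"
    by (simp add: ennreal_mult_cancel_left)
qed

lemma is_szego_transform_szego_transform:
  assumes "prob_measure_on \<nu> {-1..1}"
  shows "is_szego_transform \<nu> (szego_transform \<nu>)"
  unfolding szego_transform_def
proof (rule theI)
  show w: "is_szego_transform \<nu> (szego_witness \<nu>)"
    using assms by (rule is_szego_transform_witness)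
  show "\<sigma> = szego_witness \<nu>" if "is_szego_transform \<nu> \<sigma>" for \<sigma>
    using that w by (rule is_szego_transform_unique)
qed

end

theory Submission
  imports Defs
begin

text \<open>Let \<open>Q\<^sub>n\<close> be the orthogonal polynomials on the line and \<open>x = (z + 1/z)/2\<close>. For \<open>n \<ge> 1\<close>,
  by uniqueness, \<open>(2z)\<^sup>n Q\<^sub>n(x) = z \<Phi>(z) + \<Phi>\<^sup>*(z)\<close> with \<open>\<Phi>\<close> of degree \<open>2n - 1\<close>, since both
  sides are monic of degree \<open>2n\<close> with constant term 1 and orthogonal to \<open>z, z^2, \<dots>, z^(2n - 1)\<close>.
  Comparing the coefficients of \<open>z\<close> gives \<open>b\<close>, and comparing the squared norms gives \<open>d\<close>. The
  symmetry of the measure on the circle makes all polynomials real.\<close>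

section \<open>Linear functionals on polynomials\<close>

lemma linear_functional_poly_expand:
  fixes L :: "'a::comm_ring_1 poly \<Rightarrow> 'a"
  assumes add: "\<And>p q. L (p + q) = L p + L q" and smult: "\<And>c p. L (smult c p) = c * L p"
  shows "L p = (\<Sum>i\<le>degree p. coeff p i * L (monom 1 i))"
proof -
  have L0: "L 0 = 0"
    using smult[of 0 0] by simp
  have sum: "L (sum f A) = (\<Sum>i\<in>A. L (f i))" if "finite A" for f and A :: "nat set"
    using that by induction (simp_all add: L0 add)
  have "L p = L (\<Sum>i\<le>degree p. smult (coeff p i) (monom 1 i))"
    by (simp add: smult_monom poly_as_sum_of_monoms)
  then show ?thesis
    by (simp add: sum smult)
qed

text \<open>Subtracting a multiple of \<open>V (degree p)\<close> cancels the leading term of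
  \<open>p\<close>, so strong induction on the degree applies. A general coefficient ring lets it
  serve both the real functional on the line and the complex one on the circle.\<close>

lemma linear_functional_vanishes_below:
  fixes L :: "'a::comm_ring_1 poly \<Rightarrow> 'a"
  assumes add: "\<And>p q. L (p + q) = L p + L q" and smult: "\<And>c p. L (smult c p) = c * L p"
    and V: "\<And>n. degree (V n) = n" "\<And>n. lead_coeff (V n) = 1"
    and zero: "\<And>m. m < n \<Longrightarrow> L (V m) = 0"
    and "degree p < n"
  shows "L p = 0"
  using \<open>degree p < n\<close>
proof (induction "degree p" arbitrary: p rule: less_induct)
  case less
  define r where "r = p - smult (lead_coeff p) (V (degree p))"
  have deg: "degree r \<le> degree p"
    unfolding r_def using degree_smult_le[of "lead_coeff p" "V (degree p)"]
    by (intro degree_diff_le) (auto simp: V)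
  have c: "coeff r (degree p) = 0"
    using V(2)[of "degree p"] by (simp add: r_def V(1))
  have "L r = 0"
  \<comment> \<open>For a constant the degree cannot drop further; the remainder is then zero
    itself.\<close>
  proof (cases "degree p = 0")
    case True
    then have "r = 0"
      using deg c by (metis le_0_eq leading_coeff_0_iff)
    then show ?thesis
      using smult[of 0 0] by simp
  next
    case False
    then have "degree r < degree p"
      using deg c by (metis degree_0 le_neq_implies_less leading_coeff_0_iff neq0_conv)
    then show ?thesis
      using less by simp
  qed
  moreover have "p = r + smult (lead_coeff p) (V (degree p))"
    by (simp add: r_def)
  ultimately show ?case
    using add smult zero[OF less.prems] by (metis add_0 mult_zero_right)
qed


section \<open>Real polynomials evaluated on the unit circle\<close>

text \<open>Coefficients stay real while the argument is complex: the symmetry of the measure makes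
  all circle polynomials real, so the later algebra can take place in
  \<open>real poly\<close>.\<close>

definition ev :: "real poly \<Rightarrow> complex \<Rightarrow> complex" where
  "ev p = poly (map_poly of_real p)"

lemma ev_0 [simp]: "ev 0 z = 0"
  by (simp add: ev_def)

lemma ev_pCons [simp]: "ev (pCons a p) z = of_real a + z * ev p z"
  by (simp add: ev_def map_poly_pCons)

lemma ev_1 [simp]: "ev 1 z = 1"
  by (simp add: ev_def)

lemma ev_add [simp]: "ev (p + q) z = ev p z + ev q z"
proof -
  have "map_poly complex_of_real (p + q) = map_poly of_real p + map_poly of_real q"
    by (rule poly_eqI) (simp add: coeff_map_poly)
  then show ?thesis by (simp add: ev_def)
qed

lemma ev_smult [simp]: "ev (smult c p) z = of_real c * ev p z"
  by (induction p) (simp_all add: algebra_simps)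

lemma ev_mult [simp]: "ev (p * q) z = ev p z * ev q z"
  by (induction p) (simp_all add: algebra_simps)

lemma ev_minus [simp]: "ev (- p) z = - ev p z"
  using ev_smult[of "-1" p z] by simp

lemma ev_diff [simp]: "ev (p - q) z = ev p z - ev q z"
  using ev_add[of p "- q" z] by simp

lemma ev_monom [simp]: "ev (monom c n) z = of_real c * z ^ n"
  by (simp add: ev_def map_poly_monom poly_monom)

lemma ev_cnj: "ev p (cnj z) = cnj (ev p z)"
  by (induction p) simp_all

lemma continuous_on_ev [continuous_intros]: "continuous_on S (ev p)"
  unfolding ev_def by (intro continuous_intros)

lemma cnj_mult_self_circle: "z \<in> sphere 0 1 \<Longrightarrow> cnj z * z = 1"
  using complex_norm_square[of z] by (simp add: mult.commute)

text \<open>On the circle 1/z is the conjugate of z, so reversing the coefficients gives the starred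
  polynomial.\<close>

lemma ev_reflect_poly:
  assumes z: "z \<in> sphere 0 1"
  shows "ev (reflect_poly p) z = z ^ degree p * cnj (ev p z)"
proof -
  have "z \<noteq> 0" and inv: "inverse z = cnj z"
    using z cnj_mult_self_circle[OF z] by (auto intro!: inverse_unique simp: mult.commute)
  have "map_poly complex_of_real (reflect_poly p) = reflect_poly (map_poly of_real p)"
    by (rule poly_eqI) (simp add: coeff_map_poly coeff_reflect_poly degree_map_poly)
  then have "ev (reflect_poly p) z = z ^ degree p * ev p (inverse z)"
    using \<open>z \<noteq> 0\<close> by (simp add: ev_def poly_reflect_poly_nz degree_map_poly)
  then show ?thesis
    by (simp add: inv ev_cnj)
qed

text \<open>The witness is the Chebyshev polynomial T_n. Its recurrence T_{n+2} = 2x T_{n+1} - T_n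
  comes from multiplying z^(n+1) by z + conj z = 2 Re z.\<close>

lemma chebyshev_on_circle:
  "\<exists>p :: real poly. degree p \<le> n \<and> (\<forall>z \<in> sphere 0 1. Re (z ^ n) = poly p (Re z))"
proof (induction n rule: induct_nat_012)
  case 0
  show ?case by (intro exI[of _ 1]) simp
next
  case 1
  show ?case by (intro exI[of _ "[:0, 1:]"]) simp
next
  case (ge2 n)
  then obtain p q :: "real poly" where p: "degree p \<le> n" "\<forall>z \<in> sphere 0 1. Re (z ^ n) = poly p (Re z)"
    and q: "degree q \<le> Suc n" "\<forall>z \<in> sphere 0 1. Re (z ^ Suc n) = poly q (Re z)"
    by blast
  have "degree ([:0, 2:] * q) \<le> Suc (Suc n)"
    using degree_mult_le[of "[:0, 2:]" q] q(1) by (simp add: le_trans)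
  then have "degree ([:0, 2:] * q - p) \<le> Suc (Suc n)"
    using p(1) by (intro degree_diff_le) auto
  moreover have "Re (z ^ Suc (Suc n)) = poly ([:0, 2:] * q - p) (Re z)" if z: "z \<in> sphere 0 1" for z
  proof -
    have "z + cnj z = of_real (2 * Re z)"
      by (simp add: complex_add_cnj)
    then have "of_real (2 * Re z) * z ^ Suc n = z ^ Suc (Suc n) + (cnj z * z) * z ^ n"
      by (simp only: \<open>z + cnj z = _\<close>[symmetric]) (simp add: algebra_simps)
    then have "of_real (2 * Re z) * z ^ Suc n = z ^ Suc (Suc n) + z ^ n"
      by (simp only: cnj_mult_self_circle[OF z] mult_1)
    then have "2 * Re z * Re (z ^ Suc n) = Re (z ^ Suc (Suc n)) + Re (z ^ n)"
      by (metis Re_complex_of_real Im_complex_of_real times_complex.sel(1) plus_complex.sel(1) diff_zero mult_zero_left)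
    then show ?thesis
      using p(2) q(2) z by simp
  qed
  ultimately show ?case
    by blast
qed


section \<open>The two orthogonality functionals\<close>

text \<open>Here \<open>Q\<close> stands for the associated polynomials of order k, with
  \<open>\<beta> n\<close> for \<open>b (n + k + 1)\<close> and \<open>\<delta> n\<close> for
  \<open>d (n + k + 1)\<close>. Giving \<open>Q 0\<close> and \<open>Q 1\<close> explicitly avoids
  the index -1.\<close>

locale szego_pair =
  fixes \<nu> :: "real measure" and \<sigma> :: "complex measure" and Q :: "nat \<Rightarrow> real poly"
    and \<beta> \<delta> :: "nat \<Rightarrow> real"
  assumes nu: "prob_measure_on \<nu> {-1..1}" and szego: "is_szego_transform \<nu> \<sigma>"
    and Q_orth: "monic_orthogonal_polys \<nu> Q"
    and Q_0: "Q 0 = 1" and Q_1: "Q (Suc 0) = [:- \<beta> 0, 1:]"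
    and Q_rec: "\<And>n. Q (Suc (Suc n)) = [:- \<beta> (Suc n), 1:] * Q (Suc n) - smult (\<delta> n) (Q n)"
    and \<delta>_pos: "\<And>n. \<delta> n > 0"
begin

lemma degree_Q: "degree (Q n) = n" and lead_coeff_Q: "lead_coeff (Q n) = 1"
  using Q_orth unfolding monic_orthogonal_polys_def by blast+

lemma coeff_Q_self: "coeff (Q n) n = 1"
  using lead_coeff_Q[of n] by (simp add: degree_Q)

lemma sets_\<sigma> [measurable_cong]: "sets \<sigma> = sets borel"
  and AE_\<sigma>: "AE z in \<sigma>. z \<in> sphere 0 1"
  and prob_\<sigma>: "prob_space \<sigma>"
  and distr_cnj: "distr \<sigma> borel cnj = \<sigma>" and distr_Re: "distr \<sigma> borel Re = \<nu>"
  using szego by (auto simp: is_szego_transform_def prob_measure_on_def)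

text \<open>A continuous function is bounded on the compact circle, which carries the whole mass of
  the probability measure.\<close>

lemma integrable_\<sigma>:
  fixes f :: "complex \<Rightarrow> 'b::{banach, second_countable_topology}"
  assumes f: "continuous_on UNIV f"
  shows "integrable \<sigma> f"
proof -
  interpret prob_space \<sigma> by (rule prob_\<sigma>)
  have "compact (f ` sphere 0 1)"
    by (intro compact_continuous_image continuous_on_subset[OF f]) auto
  then obtain C where C: "\<And>z. z \<in> sphere 0 1 \<Longrightarrow> norm (f z) \<le> C"
    by (metis bounded_iff compact_imp_bounded imageI)
  show ?thesis
  proof (rule integrable_const_bound)
    show "AE z in \<sigma>. norm (f z) \<le> C"
      using AE_\<sigma> by eventually_elim (rule C)
    have "f \<in> borel_measurable borel"
      using f by (rule borel_measurable_continuous_onI)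
    then show "f \<in> borel_measurable \<sigma>"
      by measurable
  qed
qed

lemma integral_\<sigma>_cnj:
  fixes f :: "complex \<Rightarrow> 'b::{banach, second_countable_topology}"
  assumes "continuous_on UNIV f"
  shows "(\<integral>z. f (cnj z) \<partial>\<sigma>) = (\<integral>z. f z \<partial>\<sigma>)"
proof -
  have [measurable]: "f \<in> borel_measurable borel"
    using assms by (rule borel_measurable_continuous_onI)
  have "(\<integral>z. f z \<partial>distr \<sigma> borel cnj) = (\<integral>z. f (cnj z) \<partial>\<sigma>)"
    by (rule integral_distr) measurable
  then show ?thesis by (simp add: distr_cnj)
qed

lemma integral_\<sigma>_cong:
  fixes f g :: "complex \<Rightarrow> 'b::{banach, second_countable_topology}"
  assumes "continuous_on UNIV f" "continuous_on UNIV g"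
    and "\<And>z. z \<in> sphere 0 1 \<Longrightarrow> f z = g z"
  shows "(\<integral>z. f z \<partial>\<sigma>) = (\<integral>z. g z \<partial>\<sigma>)"
proof (rule integral_cong_AE)
  show "AE z in \<sigma>. f z = g z"
    using AE_\<sigma> by eventually_elim (rule assms)
qed (use assms(1,2) in \<open>auto intro: borel_measurable_integrable integrable_\<sigma>\<close>)

section \<open>Integration on the line and the squared norms of the Q_n\<close>

definition E :: "real poly \<Rightarrow> real" where
  "E p = (\<integral>x. poly p x \<partial>\<nu>)"

lemma E_eq_integral_\<sigma>: "E p = (\<integral>z. poly p (Re z) \<partial>\<sigma>)"
proof -
  have "poly p \<in> borel_measurable borel"
    by (intro borel_measurable_continuous_onI continuous_intros)
  then have "(\<integral>x. poly p x \<partial>distr \<sigma> borel Re) = (\<integral>z. poly p (Re z) \<partial>\<sigma>)"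
    by (intro integral_distr) measurable
  then show ?thesis by (simp add: E_def distr_Re)
qed

lemma E_add: "E (p + q) = E p + E q" and E_smult: "E (smult c p) = c * E p"
  unfolding E_eq_integral_\<sigma>
  by (auto intro!: Bochner_Integration.integral_add integrable_\<sigma> continuous_intros)

lemma E_diff: "E (p - q) = E p - E q"
  using E_add[of p "smult (-1) q"] E_smult[of "-1" q] by simp

lemma E_Q_Q: "m \<noteq> n \<Longrightarrow> E (Q m * Q n) = 0"
  using Q_orth by (simp add: monic_orthogonal_polys_def E_def)

lemma E_lower_mult_Q:
  assumes "degree p < n"
  shows "E (p * Q n) = 0"
  by (rule linear_functional_vanishes_below[where L = "\<lambda>p. E (p * Q n)" and V = Q and n = n])
     (auto simp: distrib_right E_add E_smult degree_Q lead_coeff_Q coeff_Q_self E_Q_Q assms)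

definition h :: "nat \<Rightarrow> real" where
  "h n = E (Q n * Q n)"

lemma E_monic_mult_Q:
  assumes "degree p = n" "coeff p n = 1"
  shows "E (p * Q n) = h n"
proof -
  have "E ((p - Q n) * Q n) = 0"
  \<comment> \<open>The zero difference is split off because for n = 0 its degree is not below
    n.\<close>
  proof (cases "p = Q n")
    case True
    then show ?thesis using E_smult[of 0 0] by simp
  next
    case False
    have "degree (p - Q n) \<le> n"
      by (intro degree_diff_le) (auto simp: assms degree_Q)
    moreover have "degree (p - Q n) \<noteq> n"
      using False assms by (metis coeff_Q_self coeff_diff diff_self eq_iff_diff_eq_0 leading_coeff_0_iff)
    ultimately show ?thesis
      by (intro E_lower_mult_Q) auto
  qed
  then show ?thesis
    by (simp add: left_diff_distrib E_diff h_def)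
qed

text \<open>Pair the recurrence for Q_{n+2} with Q_n: two of the terms vanish by orthogonality, and
  x Q_n is monic of degree n + 1, so its product with Q_{n+1} integrates to
  \<open>h (Suc n)\<close>.\<close>

lemma h_Suc: "h (Suc n) = \<delta> n * h n"
proof -
  have "E (Q (Suc (Suc n)) * Q n) = 0"
    by (simp add: E_Q_Q)
  moreover have "Q (Suc (Suc n)) * Q n =
      [:0, 1:] * Q n * Q (Suc n) - smult (\<beta> (Suc n)) (Q (Suc n) * Q n) - smult (\<delta> n) (Q n * Q n)"
    by (simp add: Q_rec algebra_simps)
  moreover have "E ([:0, 1:] * Q n * Q (Suc n)) = h (Suc n)"
  proof (rule E_monic_mult_Q)
    have "Q n \<noteq> 0"
      using lead_coeff_Q[of n] by auto
    then show "degree ([:0, 1:] * Q n) = Suc n"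
      by (simp add: degree_Q)
  qed (simp add: coeff_Q_self)
  ultimately show ?thesis
    by (simp add: E_diff E_smult E_Q_Q h_def)
qed

lemma h_pos: "h n > 0"
proof (induction n)
  case 0
  interpret prob_space \<nu> using nu by (simp add: prob_measure_on_def)
  show ?case by (simp add: h_def Q_0 E_def prob_space)
next
  case (Suc n)
  then show ?case by (simp add: h_Suc \<delta>_pos)
qed

section \<open>The real inner product on the circle\<close>

definition B :: "real poly \<Rightarrow> real poly \<Rightarrow> real" where
  "B p q = (\<integral>z. inner (ev p z) (ev q z) \<partial>\<sigma>)"

lemma continuous_inner_ev: "continuous_on UNIV (\<lambda>z. inner (ev p z) (ev q z))"
  by (intro continuous_intros)

lemma B_add: "B (p + q) r = B p r + B q r" and B_smult: "B (smult c p) r = c * B p r"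
  unfolding B_def
  by (auto intro!: Bochner_Integration.integral_add integrable_\<sigma> continuous_inner_ev
      simp: inner_add_left simp flip: scaleR_conv_of_real)

lemma B_commute: "B p q = B q p"
  by (simp add: B_def inner_commute)

lemma B_diff: "B (p - q) r = B p r - B q r"
  using B_add[of p "smult (-1) q" r] B_smult[of "-1" q r] by simp

lemma B_add_right: "B r (p + q) = B r p + B r q"
  and B_diff_right: "B r (p - q) = B r p - B r q"
  and B_smult_right: "B r (smult c p) = c * B r p"
  using B_add B_diff B_smult by (simp_all add: B_commute[of r])

lemma B_cong:
  assumes "\<And>z. z \<in> sphere 0 1 \<Longrightarrow> inner (ev p z) (ev q z) = inner (ev p' z) (ev q' z)"
  shows "B p q = B p' q'"
  unfolding B_def by (intro integral_\<sigma>_cong continuous_inner_ev assms)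

lemma inner_mult_circle:
  fixes a b z :: complex
  assumes "z \<in> sphere 0 1"
  shows "inner (z * a) (z * b) = inner a b"
proof -
  have "inner (z * a) (z * b) = Re ((cnj z * z) * (cnj a * b))"
    by (simp add: inner_complex_def algebra_simps)
  then show ?thesis
    by (simp only: cnj_mult_self_circle[OF assms]) (simp add: inner_complex_def)
qed

lemma inner_power_mult_circle:
  fixes a b z :: complex
  shows "z \<in> sphere 0 1 \<Longrightarrow> inner (z ^ n * a) (z ^ n * b) = inner a b"
  by (induction n) (simp_all add: inner_mult_circle mult.assoc)

lemma B_shift: "B (monom 1 n * p) (monom 1 n * q) = B p q"
  by (rule B_cong) (simp add: inner_power_mult_circle)

lemma inner_reflect_poly:
  assumes "z \<in> sphere 0 1" "j \<le> degree p"
  shows "inner (z ^ j) (ev (reflect_poly p) z) = inner (z ^ (degree p - j)) (ev p z)"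
proof -
  have "inner (z ^ j) (ev (reflect_poly p) z) =
      inner (z ^ j * 1) (z ^ j * (z ^ (degree p - j) * cnj (ev p z)))"
    by (simp add: ev_reflect_poly[OF assms(1)] assms(2) flip: power_add mult.assoc)
  also have "\<dots> = inner 1 (z ^ (degree p - j) * cnj (ev p z))"
    using assms by (rule_tac inner_power_mult_circle)
  also have "\<dots> = inner (z ^ (degree p - j)) (ev p z)"
    by (simp add: inner_complex_def)
  finally show ?thesis .
qed

text \<open>Reversal carries orthogonality to z^(deg p - j) over to z^j. Thus orthogonality of Phi_n
  to 1, ..., z^(n-1) becomes orthogonality of its reversal to z, ..., z^n.\<close>

lemma B_monom_reflect_poly:
  "j \<le> degree p \<Longrightarrow> B (monom 1 j) (reflect_poly p) = B (monom 1 (degree p - j)) p"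
  by (rule B_cong) (simp add: inner_reflect_poly)

lemma B_reflect_poly: "B (reflect_poly p) (reflect_poly p) = B p p"
  by (rule B_cong) (simp add: ev_reflect_poly dot_square_norm norm_mult norm_power)

text \<open>If \<open>p\<close> were a null vector, \<open>\<sigma>\<close> would live on the zeros of \<open>p\<close> and \<open>\<nu>\<close> on their finitely
  many real parts, so the monic polynomial with these roots would contradict \<open>h > 0\<close>.\<close>

lemma B_definite:
  assumes "B p p = 0"
  shows "p = 0"
proof (rule ccontr)
  assume "p \<noteq> 0"
  define Z where "Z = {z. ev p z = 0}"
  have "map_poly complex_of_real p \<noteq> 0"
    using \<open>p \<noteq> 0\<close> by (simp add: map_poly_eq_0_iff)
  then have fin: "finite Z"
    unfolding Z_def ev_def by (rule poly_roots_finite)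
  have "AE z in \<sigma>. inner (ev p z) (ev p z) = 0"
    using assms integral_nonneg_eq_0_iff_AE[OF integrable_\<sigma>[OF continuous_inner_ev]]
    by (simp add: B_def)
  then have AE: "AE z in \<sigma>. z \<in> Z"
    by eventually_elim (simp add: Z_def)
  define w where "w = (\<Prod>x\<in>Re ` Z. [:- x, 1:])"
  have monic: "lead_coeff w = 1"
    by (simp add: w_def lead_coeff_prod)
  have "E (w * Q (degree w)) = 0"
  proof -
    have "(\<integral>z. poly (w * Q (degree w)) (Re z) \<partial>\<sigma>) = 0"
    proof (rule integral_eq_zero_AE)
      show "AE z in \<sigma>. poly (w * Q (degree w)) (Re z) = 0"
        using AE by eventually_elim (use fin in \<open>auto simp: w_def poly_prod prod_zero_iff\<close>)
    qed
    then show ?thesis by (simp add: E_eq_integral_\<sigma>)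
  qed
  then show False
    using E_monic_mult_Q[of w "degree w"] monic h_pos[of "degree w"] by simp
qed

text \<open>Passing from z to conj z conjugates the integrand, so invariance of the measure makes
  the integral real. Hence \<open>B\<close>, built from real parts only, loses nothing of the
  Hermitian product.\<close>

lemma integral_cnj_mult_ev: "(\<integral>z. cnj (ev p z) * ev q z \<partial>\<sigma>) = of_real (B p q)"
proof -
  let ?f = "\<lambda>z. cnj (ev p z) * ev q z"
  have cont: "continuous_on UNIV ?f"
    by (intro continuous_intros)
  have int: "integrable \<sigma> ?f"
    by (rule integrable_\<sigma>[OF cont])
  have "cnj (\<integral>z. ?f z \<partial>\<sigma>) = (\<integral>z. ?f (cnj z) \<partial>\<sigma>)"
    by (subst integral_bounded_linear[OF bounded_linear_cnj int, symmetric]) (simp add: ev_cnj)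
  then have "Im (\<integral>z. ?f z \<partial>\<sigma>) = 0"
    by (simp add: integral_\<sigma>_cnj[OF cont] complex_eq_iff)
  moreover have "Re (\<integral>z. ?f z \<partial>\<sigma>) = B p q"
    using integral_Re[OF int] by (simp add: B_def inner_complex_def)
  ultimately show ?thesis
    by (simp add: complex_eq_iff)
qed

lemma B_left_eq_0:
  assumes "\<And>j. j \<le> degree p \<Longrightarrow> coeff p j = 0 \<or> B (monom 1 j) r = 0"
  shows "B p r = 0"
proof -
  have "B p r = (\<Sum>j\<le>degree p. coeff p j * B (monom 1 j) r)"
    by (rule linear_functional_poly_expand) (simp_all add: B_add B_smult)
  then show ?thesis
    using assms by (simp add: sum.neutral)
qed

text \<open>Such a \<open>p\<close> is a combination of z, ..., z^N, to all of which it is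
  orthogonal, so it is orthogonal to itself. This is the uniqueness principle behind both the Szego
  recursion and the link between line and circle.\<close>

lemma B_determined:
  assumes "degree p \<le> N" "coeff p 0 = 0" "\<And>j. 1 \<le> j \<Longrightarrow> j \<le> N \<Longrightarrow> B (monom 1 j) p = 0"
  shows "p = 0"
proof (rule B_definite, rule B_left_eq_0)
  show "coeff p j = 0 \<or> B (monom 1 j) p = 0" if "j \<le> degree p" for j
    using that assms by (cases "j = 0") auto
qed


section \<open>The polynomials on the line in terms of the circle variable\<close>

text \<open>This is (2z)^n Q_n(x) with x = (z + 1/z)/2, as a polynomial in z. The recurrence of
  \<open>Q\<close> is multiplied by (2z)^(n+2), using 2z(x - \<beta>) = 1 - 2\<beta>z + z^2 and
  (2z)^2 = 4z^2.\<close>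

fun q :: "nat \<Rightarrow> real poly" where
  "q 0 = 1"
| "q (Suc 0) = [:1, - 2 * \<beta> 0, 1:]"
| "q (Suc (Suc n)) = [:1, - 2 * \<beta> (Suc n), 1:] * q (Suc n) - smult (4 * \<delta> n) ([:0, 0, 1:] * q n)"

lemma ev_q: "z \<in> sphere 0 1 \<Longrightarrow> ev (q n) z = (2 * z) ^ n * of_real (poly (Q n) (Re z))"
proof (induction n rule: induct_nat_012)
  have two: "2 * z * of_real (Re z) = 1 + z * z" if "z \<in> sphere 0 1" for z
  proof -
    have "2 * z * of_real (Re z) = z * (z + cnj z)"
      by (simp add: complex_add_cnj)
    also have "\<dots> = cnj z * z + z * z"
      by (simp add: algebra_simps)
    finally show ?thesis
      by (simp only: cnj_mult_self_circle[OF that])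
  qed
  {
    case 1
    then show ?case using two[of z] by (simp add: Q_1 algebra_simps)
  next
    case (ge2 n)
    let ?x = "complex_of_real (Re z)"
    have "ev [:1, - 2 * \<beta> (Suc n), 1:] z = 1 + z * z - 2 * z * of_real (\<beta> (Suc n))"
      by (simp add: algebra_simps)
    also have "\<dots> = 2 * z * (?x - of_real (\<beta> (Suc n)))"
      by (simp only: two[OF ge2.prems, symmetric]) (simp add: algebra_simps)
    finally have quad: "ev [:1, - 2 * \<beta> (Suc n), 1:] z = 2 * z * (?x - of_real (\<beta> (Suc n)))" .
    have "ev (q (Suc (Suc n))) z =
        ev [:1, - 2 * \<beta> (Suc n), 1:] z * ev (q (Suc n)) z - 4 * of_real (\<delta> n) * z\<^sup>2 * ev (q n) z"
      by (simp add: power2_eq_square algebra_simps)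
    also have "\<dots> = (2 * z) ^ Suc (Suc n) * of_real (poly (Q (Suc (Suc n))) (Re z))"
      unfolding quad ge2.IH(1)[OF ge2.prems] ge2.IH(2)[OF ge2.prems]
      by (simp add: Q_rec power2_eq_square algebra_simps)
    finally show ?case .
  }
qed (simp add: Q_0)

lemma degree_coeff_q:
  "degree (q n) \<le> 2 * n \<and> coeff (q n) (2 * n) = 1 \<and> coeff (q n) 0 = 1"
proof (induction n rule: induct_nat_012)
  case (ge2 n)
  have "degree ([:1, - 2 * \<beta> (Suc n), 1:] * q (Suc n)) \<le> 2 * Suc (Suc n)"
    using degree_mult_le[of "[:1, - 2 * \<beta> (Suc n), 1:]" "q (Suc n)"] ge2 by simp
  moreover have "degree ([:0, 0, 1:] * q n) \<le> 2 * Suc (Suc n)"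
    using degree_mult_le[of "[:0, 0, 1:]" "q n"] ge2 by (simp del: mult_pCons_left)
  ultimately have "degree (q (Suc (Suc n))) \<le> 2 * Suc (Suc n)"
    by (simp del: mult_pCons_left add: degree_diff_le degree_smult_le[THEN order_trans])
  \<comment> \<open>With these coefficients beyond the degree bounds gone, only z^2 times the top
    term of \<open>q (Suc n)\<close> reaches the top of the new polynomial.\<close>
  moreover have "coeff (q (Suc n)) (Suc (2 * Suc n)) = 0" "coeff (q (Suc n)) (Suc (Suc (2 * Suc n))) = 0"
      "coeff (q n) (Suc (Suc (2 * n))) = 0"
    using ge2 by (auto intro!: coeff_eq_0)
  ultimately show ?case
    using ge2 by (simp add: coeff_pCons)
qed (simp_all add: numeral_2_eq_2)

text \<open>The subtracted term of the recurrence is divisible by z^2, and the constant term of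
  \<open>q n\<close> is 1.\<close>

lemma coeff_1_q_Suc: "coeff (q (Suc n)) 1 = coeff (q n) 1 - 2 * \<beta> n"
proof (cases n)
  case (Suc m)
  then show ?thesis
    using degree_coeff_q[of "Suc m"] by simp
qed simp

lemma B_q_q: "B (q n) (q n) = 4 ^ n * h n"
proof -
  have "B (q n) (q n) = (\<integral>z. poly (smult (4 ^ n) (Q n * Q n)) (Re z) \<partial>\<sigma>)"
    unfolding B_def
  proof (intro integral_\<sigma>_cong continuous_inner_ev)
    have power4: "((2::real) ^ n)\<^sup>2 = 4 ^ n"
      by (simp add: power2_eq_square flip: power_mult_distrib)
    fix z :: complex
    assume z: "z \<in> sphere 0 1"
    then have "norm (ev (q n) z) = 2 ^ n * \<bar>poly (Q n) (Re z)\<bar>"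
      by (simp add: ev_q norm_mult norm_power)
    then have "inner (ev (q n) z) (ev (q n) z) = (2 ^ n * \<bar>poly (Q n) (Re z)\<bar>)\<^sup>2"
      by (simp add: dot_square_norm)
    then show "inner (ev (q n) z) (ev (q n) z) = poly (smult (4 ^ n) (Q n * Q n)) (Re z)"
      by (simp add: power_mult_distrib power4) (simp add: power2_eq_square)
  qed (intro continuous_intros)
  then show ?thesis
    by (simp only: E_eq_integral_\<sigma>[symmetric] E_smult h_def)
qed

text \<open>Against z^j the factor z^n leaves Re z^|n - j|, a Chebyshev polynomial in x of degree
  below n, to which Q_n is orthogonal.\<close>

lemma B_monom_q:
  assumes "1 \<le> j" "j < 2 * n"
  shows "B (monom 1 j) (q n) = 0"
proof -
  \<comment> \<open>This is |n - j| without truncated subtraction; the bounds 1 <= j < 2n say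
    precisely that it is below n.\<close>
  define i where "i = (if j \<le> n then n - j else j - n)"
  have "i < n"
    using assms by (auto simp: i_def)
  obtain p :: "real poly" where p: "degree p \<le> i" "\<And>z. z \<in> sphere 0 1 \<Longrightarrow> Re (z ^ i) = poly p (Re z)"
    using chebyshev_on_circle[of i] by blast
  have "B (monom 1 j) (q n) = (\<integral>z. poly (smult (2 ^ n) (p * Q n)) (Re z) \<partial>\<sigma>)"
    unfolding B_def
  proof (intro integral_\<sigma>_cong continuous_inner_ev)
    fix z :: complex
    assume z: "z \<in> sphere 0 1"
    have "inner (z ^ j) (z ^ n) = Re (z ^ i)"
    \<comment> \<open>The smaller of the two powers is cancelled from both arguments.\<close>
    proof (cases "j \<le> n")
      case True
      then show ?thesis
        using inner_power_mult_circle[OF z, of j 1 "z ^ i"]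
        by (simp add: i_def inner_complex_def flip: power_add)
    next
      case False
      then show ?thesis
        using inner_power_mult_circle[OF z, of n "z ^ i" 1]
        by (simp add: i_def inner_complex_def flip: power_add)
    qed
    moreover have "ev (q n) z = (2 ^ n * poly (Q n) (Re z)) *\<^sub>R z ^ n"
      by (simp add: ev_q[OF z] power_mult_distrib scaleR_conv_of_real)
    ultimately show "inner (ev (monom 1 j) z) (ev (q n) z) = poly (smult (2 ^ n) (p * Q n)) (Re z)"
      using p(2)[OF z] by simp
  qed (intro continuous_intros)
  also have "\<dots> = 0"
    using E_lower_mult_Q[of p n] p(1) \<open>i < n\<close>
    by (simp only: E_eq_integral_\<sigma>[symmetric] E_smult)
  finally show ?thesis .
qed

end


section \<open>Orthogonal polynomials on the circle\<close>

locale szego_opuc = szego_pair +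
  fixes \<Phi> :: "nat \<Rightarrow> complex poly"
  assumes \<Phi>_orth: "monic_orthogonal_polys_circle \<sigma> \<Phi>"
begin

lemma degree_\<Phi>: "degree (\<Phi> n) = n" and lead_coeff_\<Phi>: "lead_coeff (\<Phi> n) = 1"
  using \<Phi>_orth unfolding monic_orthogonal_polys_circle_def by blast+

lemma coeff_\<Phi>_self: "coeff (\<Phi> n) n = 1"
  using lead_coeff_\<Phi>[of n] by (simp add: degree_\<Phi>)

lemma integral_cnj_\<Phi>_mult_lower:
  assumes "degree p < n"
  shows "(\<integral>z. cnj (poly (\<Phi> n) z) * poly p z \<partial>\<sigma>) = 0"
proof (rule linear_functional_vanishes_below[where V = \<Phi> and n = n and p = p])
  have int: "integrable \<sigma> (\<lambda>z. cnj (poly (\<Phi> n) z) * poly p z)" for p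
    by (intro integrable_\<sigma> continuous_intros)
  show "(\<integral>z. cnj (poly (\<Phi> n) z) * poly (p + q) z \<partial>\<sigma>) =
      (\<integral>z. cnj (poly (\<Phi> n) z) * poly p z \<partial>\<sigma>) + (\<integral>z. cnj (poly (\<Phi> n) z) * poly q z \<partial>\<sigma>)" for p q
    by (simp add: distrib_left Bochner_Integration.integral_add[OF int int])
  show "(\<integral>z. cnj (poly (\<Phi> n) z) * poly (smult c p) z \<partial>\<sigma>) =
      c * (\<integral>z. cnj (poly (\<Phi> n) z) * poly p z \<partial>\<sigma>)" for c p
    by (simp add: mult.left_commute)
  show "(\<integral>z. cnj (poly (\<Phi> n) z) * poly (\<Phi> m) z \<partial>\<sigma>) = 0" if "m < n" for m
    using \<Phi>_orth that by (simp add: monic_orthogonal_polys_circle_def)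
qed (simp_all add: degree_\<Phi> coeff_\<Phi>_self assms)

section \<open>Reality of the circle polynomials\<close>

lemma poly_eq_ev_Re_Im: "poly p z = ev (map_poly Re p) z + \<i> * ev (map_poly Im p) z"
proof (induction p)
  case (pCons a p)
  have "a = of_real (Re a) + \<i> * of_real (Im a)"
    by (rule complex_eq)
  then show ?case
    using pCons by (simp add: map_poly_pCons algebra_simps)
qed simp

text \<open>The pairing of \<open>\<Phi> n\<close> with z^j is zero and splits into one value of
  \<open>B\<close> minus \<open>\<i>\<close> times another. Both values are real, so each
  vanishes.\<close>

lemma B_Re_Im_\<Phi>:
  assumes "j < n"
  shows "B (monom 1 j) (map_poly Re (\<Phi> n)) = 0" "B (monom 1 j) (map_poly Im (\<Phi> n)) = 0"
proof -
  let ?R = "map_poly Re (\<Phi> n)" and ?I = "map_poly Im (\<Phi> n)"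
  have int: "integrable \<sigma> (\<lambda>z. cnj (ev p z) * ev q z)" for p q
    by (intro integrable_\<sigma> continuous_intros)
  have "0 = (\<integral>z. cnj (poly (\<Phi> n) z) * poly (monom 1 j) z \<partial>\<sigma>)"
    using assms by (simp add: integral_cnj_\<Phi>_mult_lower degree_monom_eq)
  also have "\<dots> = (\<integral>z. cnj (ev ?R z) * ev (monom 1 j) z - \<i> * (cnj (ev ?I z) * ev (monom 1 j) z) \<partial>\<sigma>)"
    by (simp add: poly_eq_ev_Re_Im[of "\<Phi> n"] poly_monom algebra_simps)
  also have "\<dots> = of_real (B ?R (monom 1 j)) - \<i> * of_real (B ?I (monom 1 j))"
    by (subst Bochner_Integration.integral_diff[OF int integrable_mult_right[OF int]])
       (simp only: integral_mult_right_zero integral_cnj_mult_ev)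
  finally show "B (monom 1 j) ?R = 0" "B (monom 1 j) ?I = 0"
    by (simp_all add: complex_eq_iff B_commute)
qed

definition R :: "nat \<Rightarrow> real poly" where
  "R n = map_poly Re (\<Phi> n)"

text \<open>The imaginary part of \<open>\<Phi> n\<close> is orthogonal to itself, since \<open>\<sigma>\<close> is symmetric.\<close>

lemma \<Phi>_eq_R: "\<Phi> n = map_poly of_real (R n)"
proof -
  let ?I = "map_poly Im (\<Phi> n)"
  have "?I = 0"
  proof (rule B_definite, rule B_left_eq_0)
    fix j
    assume "j \<le> degree ?I"
    then have "j \<le> n"
      using map_poly_degree_leq[of Im "\<Phi> n"] by (simp add: degree_\<Phi>)
    then show "coeff ?I j = 0 \<or> B (monom 1 j) ?I = 0"
      using B_Re_Im_\<Phi>(2)[of j n] by (cases "j = n") (auto simp: coeff_map_poly coeff_\<Phi>_self)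
  qed
  then have "Im (coeff (\<Phi> n) j) = 0" for j
    by (metis coeff_0 coeff_map_poly zero_complex.sel(2))
  then show ?thesis
    by (intro poly_eqI) (simp add: R_def coeff_map_poly complex_eq_iff)
qed

lemma degree_R: "degree (R n) = n"
  using degree_\<Phi>[of n] by (subst (asm) \<Phi>_eq_R) (simp add: degree_map_poly)

lemma coeff_R_self: "coeff (R n) n = 1"
  by (simp add: R_def coeff_map_poly coeff_\<Phi>_self)

lemma B_monom_R: "j < n \<Longrightarrow> B (monom 1 j) (R n) = 0"
  by (simp add: R_def B_Re_Im_\<Phi>)

lemma B_lower_R: "degree p < n \<Longrightarrow> B p (R n) = 0"
  by (rule B_left_eq_0) (simp add: B_monom_R)

section \<open>Real Verblunsky coefficients and the Szego recursion\<close>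

definition a :: "nat \<Rightarrow> real" where
  "a n = - coeff (R (Suc n)) 0"

lemma verblunsky_coeff_eq: "verblunsky_coeff \<Phi> n = of_real (a n)"
  by (simp add: verblunsky_coeff_def a_def poly_0_coeff_0 \<Phi>_eq_R[of "Suc n"] coeff_map_poly)

text \<open>The starred polynomial of Phi_n. Since \<open>R n\<close> has degree exactly n, the
  reversal is taken at n even if its constant term vanishes.\<close>

definition S :: "nat \<Rightarrow> real poly" where
  "S n = reflect_poly (R n)"

lemma coeff_S: "coeff (S n) j = (if j \<le> n then coeff (R n) (n - j) else 0)"
  by (simp add: S_def coeff_reflect_poly degree_R)

lemma degree_S: "degree (S n) \<le> n"
  using degree_reflect_poly_le[of "R n"] by (simp add: S_def degree_R)

lemma B_monom_S:
  assumes "1 \<le> j" "j \<le> n"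
  shows "B (monom 1 j) (S n) = 0"
  using assms by (simp add: S_def B_monom_reflect_poly degree_R B_monom_R)

definition zR :: "nat \<Rightarrow> real poly" where
  "zR n = monom 1 1 * R n"

lemma coeff_zR: "coeff (zR n) j = (if j = 0 then 0 else coeff (R n) (j - 1))"
  by (simp add: zR_def coeff_monom_mult)

lemma B_monom_zR:
  assumes "1 \<le> j" "j \<le> n"
  shows "B (monom 1 j) (zR n) = 0"
proof -
  have "monom (1::real) j = monom 1 1 * monom 1 (j - 1)"
    using assms by (simp add: mult_monom)
  then show ?thesis
    using assms by (simp only: zR_def B_shift) (simp add: B_monom_R)
qed

text \<open>Both sides are monic of degree n + 1, have constant term \<open>- a n\<close>, and are
  orthogonal to z, ..., z^n, so \<open>B_determined\<close> applies to their difference.\<close>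

lemma szego_recursion: "R (Suc n) = zR n - smult (a n) (S n)"
proof -
  define D where "D = R (Suc n) - zR n + smult (a n) (S n)"
  have "D = 0"
  proof (rule B_determined)
    show "degree D \<le> n"
    proof (rule degree_le, intro allI impI)
      fix i
      assume "n < i"
      then show "coeff D i = 0"
        by (cases "i = Suc n")
           (simp_all add: D_def coeff_zR coeff_S coeff_R_self coeff_eq_0 degree_R)
    qed
    show "coeff D 0 = 0"
      by (simp add: D_def coeff_zR coeff_S coeff_R_self a_def)
    show "B (monom 1 j) D = 0" if "1 \<le> j" "j \<le> n" for j
      using that
      by (simp add: D_def B_add_right B_diff_right B_smult_right B_monom_R B_monom_zR B_monom_S)
  qed
  then show ?thesis
    by (simp add: D_def algebra_simps)
qed

text \<open>The relation between line and circle: \<open>zR\<close> supplies the leading coefficient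
  1 and \<open>S\<close> the constant term 1, while all three polynomials are orthogonal to z, ...,
  z^(2n+1).\<close>

lemma zR_plus_S_eq_q: "zR (2 * n + 1) + S (2 * n + 1) = q (n + 1)"
proof -
  define D where "D = zR (2 * n + 1) + S (2 * n + 1) - q (n + 1)"
  have q: "degree (q (n + 1)) \<le> 2 * n + 2" "coeff (q (n + 1)) (2 * n + 2) = 1" "coeff (q (n + 1)) 0 = 1"
    using degree_coeff_q[of "n + 1"] by simp_all
  have "D = 0"
  proof (rule B_determined)
    show "degree D \<le> 2 * n + 1"
    proof (rule degree_le, intro allI impI)
      fix i
      assume i: "2 * n + 1 < i"
      show "coeff D i = 0"
      proof (cases "i = 2 * n + 2")
        case True
        then show ?thesis
          using q coeff_R_self[of "2 * n + 1"] by (simp add: D_def coeff_zR coeff_S)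
      next
        case False
        then show ?thesis
          using i q by (simp add: D_def coeff_zR coeff_S coeff_eq_0 degree_R)
      qed
    qed
    show "coeff D 0 = 0"
      using q coeff_R_self[of "2 * n + 1"] by (simp add: D_def coeff_zR coeff_S)
    show "B (monom 1 j) D = 0" if "1 \<le> j" "j \<le> 2 * n + 1" for j
      using that B_monom_zR[of j "2 * n + 1"] B_monom_S[of j "2 * n + 1"] B_monom_q[of j "n + 1"]
      by (simp add: D_def B_add_right B_diff_right)
  qed
  then show ?thesis
    by (simp add: D_def)
qed

section \<open>Comparison of the coefficients of z\<close>

lemma subleading_R: "coeff (R (Suc (Suc n))) (Suc n) = coeff (R (Suc n)) n + a (Suc n) * a n"
  \<comment> \<open>The coefficient of z^(n+1) in \<open>S (Suc n)\<close> is the constant term of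
    \<open>R (Suc n)\<close>, that is \<open>- a n\<close>; hence the plus sign.\<close>
  by (subst szego_recursion) (simp add: coeff_zR coeff_S a_def)

lemma coeff_1_q: "coeff (q (n + 1)) 1 = coeff (R (2 * n + 1)) (2 * n) - a (2 * n)"
  using arg_cong[OF zR_plus_S_eq_q[of n], of "\<lambda>p. coeff p 1"]
  by (simp add: coeff_zR coeff_S a_def)

lemma \<beta>_0: "\<beta> 0 = a 0"
  using coeff_1_q[of 0] by (simp add: a_def)

text \<open>One step on the line is two on the circle: the change in the coefficient of z from
  \<open>q (n + 1)\<close> to \<open>q (n + 2)\<close> is computed by \<open>coeff_1_q_Suc\<close>
  and again by two uses of \<open>subleading_R\<close>.\<close>

lemma \<beta>_Suc: "2 * \<beta> (Suc n) = (1 - a (2 * n + 1)) * a (2 * n + 2) - (1 + a (2 * n + 1)) * a (2 * n)"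
  using coeff_1_q_Suc[of "n + 1"] coeff_1_q[of n] coeff_1_q[of "n + 1"]
    subleading_R[of "2 * n"] subleading_R[of "2 * n + 1"]
  by (simp add: algebra_simps del: q.simps)

section \<open>Comparison of squared norms\<close>

definition \<kappa> :: "nat \<Rightarrow> real" where
  "\<kappa> n = B (R n) (R n)"

lemma \<kappa>_nonzero: "\<kappa> n \<noteq> 0"
  using B_definite[of "R n"] coeff_R_self[of n] by (auto simp: \<kappa>_def)

lemma B_zR_zR: "B (zR n) (zR n) = \<kappa> n"
  by (simp only: zR_def B_shift \<kappa>_def)

lemma B_S_S: "B (S n) (S n) = \<kappa> n"
  by (simp add: S_def B_reflect_poly \<kappa>_def)

text \<open>Replace \<open>zR n\<close> by the Szego recursion; \<open>S n\<close> has degree at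
  most n and is orthogonal to \<open>R (Suc n)\<close>.\<close>

lemma B_S_zR: "B (S n) (zR n) = a n * \<kappa> n"
proof -
  have "zR n = R (Suc n) + smult (a n) (S n)"
    by (simp add: szego_recursion)
  moreover have "B (S n) (R (Suc n)) = 0"
    using degree_S[of n] by (intro B_lower_R) simp
  ultimately show ?thesis
    by (simp add: B_add_right B_smult_right B_S_S)
qed

lemma B_zR_S: "B (zR n) (S n) = a n * \<kappa> n"
  using B_S_zR[of n] by (simp add: B_commute)

lemma \<kappa>_Suc: "\<kappa> (Suc n) = \<kappa> n * (1 - (a n)\<^sup>2)"
  unfolding \<kappa>_def[of "Suc n"] szego_recursion
  by (simp add: B_diff B_diff_right B_smult B_smult_right B_zR_zR B_S_S B_S_zR
      B_zR_S power2_eq_square algebra_simps)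

text \<open>The squared norm of \<open>q (n + 1)\<close> computed twice: on the line, and on the
  circle by expanding the square of \<open>zR + S\<close>, whose two cross terms produce the factor
  1 + a.\<close>

lemma h_eq: "4 ^ Suc n * h (Suc n) = 2 * \<kappa> (2 * n + 1) * (1 + a (2 * n + 1))"
proof -
  have "4 ^ (n + 1) * h (n + 1) = B (zR (2 * n + 1) + S (2 * n + 1)) (zR (2 * n + 1) + S (2 * n + 1))"
    by (simp only: zR_plus_S_eq_q B_q_q)
  then show ?thesis
    by (simp add: B_add B_add_right B_zR_zR B_S_S B_S_zR B_zR_S algebra_simps)
qed

text \<open>It is the ratio of consecutive nonzero squared norms. This secures the denominators in
  the claim.\<close>

lemma one_minus_a_sq_nonzero: "1 - (a n)\<^sup>2 \<noteq> 0"
  using \<kappa>_Suc[of n] \<kappa>_nonzero[of "Suc n"] by auto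

lemma one_minus_a_nonzero: "1 - a n \<noteq> 0" and one_plus_a_nonzero: "1 + a n \<noteq> 0"
proof -
  have "1 - (a n)\<^sup>2 = (1 - a n) * (1 + a n)"
    by (simp add: power2_eq_square algebra_simps)
  then show "1 - a n \<noteq> 0" "1 + a n \<noteq> 0"
    using one_minus_a_sq_nonzero[of n] by auto
qed

text \<open>The starting norm is compared directly, \<open>\<kappa> 0 = h 0\<close>, as
  \<open>h_eq\<close> begins at \<open>h 1\<close>. This is why 2 stands here in place of 4, in
  agreement with 1 - a_{-1} = 2.\<close>

lemma \<delta>_0: "2 * \<delta> 0 = (1 - (a 0)\<^sup>2) * (1 + a 1)"
proof -
  have "\<kappa> 0 = h 0"
  proof -
    have "R 0 = 1"
      using degree_R[of 0] coeff_R_self[of 0] by (metis degree_eq_zeroE coeff_pCons_0 one_pCons)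
    then show ?thesis
      using B_q_q[of 0] by (simp add: \<kappa>_def)
  qed
  then show ?thesis
    using h_eq[of 0] h_Suc[of 0] \<kappa>_Suc[of 0] \<kappa>_nonzero[of 0] by simp
qed

lemma \<delta>_Suc:
  "4 * \<delta> (Suc n) = (1 - a (2 * n + 1)) * (1 - (a (2 * n + 2))\<^sup>2) * (1 + a (2 * n + 3))"
proof -
  \<comment> \<open>By \<open>h_eq\<close> this is 4^(n+1) \<open>h (n + 1)\<close>. Two steps of
    \<open>\<kappa>_Suc\<close> lead to the next norm, and splitting 1 - a^2 there makes
    \<open>?c\<close> reappear as a factor to cancel.\<close>
  let ?c = "2 * \<kappa> (2 * n + 1) * (1 + a (2 * n + 1))"
  have "4 * \<delta> (Suc n) * ?c = 4 ^ Suc (Suc n) * h (Suc (Suc n))"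
    using h_eq[of n] by (simp add: h_Suc[of "Suc n"])
  also have "\<dots> = 2 * \<kappa> (2 * n + 3) * (1 + a (2 * n + 3))"
    by (subst h_eq) (simp add: numeral_3_eq_3)
  also have "\<kappa> (2 * n + 3) = \<kappa> (2 * n + 1) * (1 - (a (2 * n + 1))\<^sup>2) * (1 - (a (2 * n + 2))\<^sup>2)"
    using \<kappa>_Suc[of "2 * n + 1"] \<kappa>_Suc[of "2 * n + 2"] by (simp add: numeral_3_eq_3)
  also have "1 - (a (2 * n + 1))\<^sup>2 = (1 - a (2 * n + 1)) * (1 + a (2 * n + 1))"
    by (simp add: power2_eq_square algebra_simps)
  finally have "4 * \<delta> (Suc n) * ?c =
      (1 - a (2 * n + 1)) * (1 - (a (2 * n + 2))\<^sup>2) * (1 + a (2 * n + 3)) * ?c"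
    by (simp only: mult_ac)
  moreover have "?c \<noteq> 0"
    using \<kappa>_nonzero one_plus_a_nonzero by simp
  ultimately show ?thesis
    by (simp only: mult_cancel_right) simp
qed

lemma a_1: "a 1 = - 1 + 2 * \<delta> 0 / (1 - (a 0)\<^sup>2)"
  using one_minus_a_sq_nonzero[of 0] by (simp add: \<delta>_0)

lemma a_even:
  assumes "m \<ge> 1"
  shows "a (2 * m) = (2 * \<beta> m + (1 + a (2 * m - 1)) * a (2 * m - 2)) / (1 - a (2 * m - 1))"
proof -
  obtain n where "m = Suc n"
    using assms by (cases m) auto
  then show ?thesis
    using \<beta>_Suc[of n] one_minus_a_nonzero[of "2 * n + 1"] by (simp add: field_simps)
qed

lemma a_odd:
  assumes "m \<ge> 1"
  shows "a (2 * m + 1) = - 1 + 4 * \<delta> m / ((1 - a (2 * m - 1)) * (1 - (a (2 * m))\<^sup>2))"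
proof -
  obtain n where "m = Suc n"
    using assms by (cases m) auto
  then show ?thesis
    using \<delta>_Suc[of n] one_minus_a_nonzero[of "2 * n + 1"] one_minus_a_sq_nonzero[of "2 * n + 2"]
    by (simp add: numeral_3_eq_3)
qed

end

theorem theorem1:
  fixes \<mu> \<mu>k :: "real measure" and P :: "nat \<Rightarrow> real poly" and b d :: "nat \<Rightarrow> real"
    and k :: nat and \<Phi> :: "nat \<Rightarrow> complex poly" and \<alpha> :: "nat \<Rightarrow> complex"
  assumes "prob_measure_on \<mu> {-1..1}" and "infinite (measure_support \<mu>)"
    and "monic_orthogonal_polys \<mu> P" and "recurrence_coeffs P b d"
    and "prob_measure_on \<mu>k {-1..1}" and "monic_orthogonal_polys \<mu>k (associated_poly b d k)"
    and "monic_orthogonal_polys_circle (szego_transform \<mu>k) \<Phi>"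
    and "\<alpha> = verblunsky_coeff \<Phi>"
  shows "\<alpha> 0 = of_real (b (k + 1)) \<and>
    \<alpha> 1 = - 1 + 2 * of_real (d (k + 1)) / (1 - (\<alpha> 0)\<^sup>2) \<and>
    (\<forall>m\<ge>1. \<alpha> (2 * m) =
      (2 * of_real (b (m + k + 1)) + (1 + \<alpha> (2 * m - 1)) * \<alpha> (2 * m - 2)) / (1 - \<alpha> (2 * m - 1))) \<and>
    (\<forall>m\<ge>1. \<alpha> (2 * m + 1) =
      - 1 + 4 * of_real (d (m + k + 1)) / ((1 - \<alpha> (2 * m - 1)) * (1 - (\<alpha> (2 * m))\<^sup>2)))"
proof -
  \<comment> \<open>Shifting by k + 1 makes both sequences start at 0; their \<delta> is positive
    because every index n + k + 1 is at least 1.\<close>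
  interpret szego_opuc \<mu>k "szego_transform \<mu>k" "associated_poly b d k"
    "\<lambda>n. b (n + k + 1)" "\<lambda>n. d (n + k + 1)" \<Phi>
    using assms(4-7) is_szego_transform_szego_transform[OF assms(5)]
    by unfold_locales (auto simp: recurrence_coeffs_def)
  have \<alpha>: "\<alpha> n = of_real (a n)" for n
    using assms(8) verblunsky_coeff_eq by simp
  show ?thesis
  proof (intro conjI allI impI)
    show "\<alpha> 0 = of_real (b (k + 1))"
      using \<beta>_0 by (simp add: \<alpha>)
    show "\<alpha> 1 = - 1 + 2 * of_real (d (k + 1)) / (1 - (\<alpha> 0)\<^sup>2)"
      unfolding \<alpha> by (subst a_1) simp
    fix m :: nat
    assume m: "m \<ge> 1"
    show "\<alpha> (2 * m) = (2 * of_real (b (m + k + 1)) + (1 + \<alpha> (2 * m - 1)) * \<alpha> (2 * m - 2)) / (1 - \<alpha> (2 * m - 1))"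
      unfolding \<alpha> by (subst a_even[OF m]) simp
    show "\<alpha> (2 * m + 1) = - 1 + 4 * of_real (d (m + k + 1)) / ((1 - \<alpha> (2 * m - 1)) * (1 - (\<alpha> (2 * m))\<^sup>2))"
      unfolding \<alpha> by (subst a_odd[OF m]) simp
  qed
qed

end
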